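(* Suppose $|\mathbb F|=q<\infty$. If $1\leq r\leq\min(m,n)$ and we do not have $r=m=n$, then $$\operatorname{rank}(P)=\operatorname{rank}(\operatorname{Reg}(\mathcal M_{mn}^J))=q^{r(L-r)}+1,$$ where $L=\max(m,n)$.
   Context: Let $\mathbb F$ be a field and $m,n\geq1$ integers. $\mathcal M_{kl}$ denotes the set of all $k\times l$ matrices over $\mathbb F$. Let $J=\begin{bmatrix}I_r&O\\O&O\end{bmatrix}\in\mathcal M_{nm}$ (an $n\times m$ matrix of rank $r$), and let $\mathcal M_{mn}^J$ be the semigroup with underlying set $\mathcal M_{mn}$ and operation $X\star Y=XJY$. $P=\operatorname{Reg}(\mathcal M_{mn}^J)$ is the subsemigroup of all regular elements (those $X$ with $X=X\star Y\star X$ for some $Y$). For a semigroup $S$, $\operatorname{rank}(S)$ is the minimum size of a generating set for $S$ (as a semigroup). *)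

theory Defs
  imports "Jordan_Normal_Form.Matrix" "HOL-Library.Extended_Nat"
begin

inductive_set semigroup_span :: "('b \<Rightarrow> 'b \<Rightarrow> 'b) \<Rightarrow> 'b set \<Rightarrow> 'b set"
  for f :: "'b \<Rightarrow> 'b \<Rightarrow> 'b" and A :: "'b set" where
  base: "x \<in> A \<Longrightarrow> x \<in> semigroup_span f A"
| mult: "x \<in> semigroup_span f A \<Longrightarrow> y \<in> semigroup_span f A \<Longrightarrow> f x y \<in> semigroup_span f A"

text \<open>The value is \<open>\<infinity>\<close> exactly when the semigroup is not finitely generated.\<close>

definition semigroup_rank :: "('b \<Rightarrow> 'b \<Rightarrow> 'b) \<Rightarrow> 'b set \<Rightarrow> enat" where
  "semigroup_rank f S =
     Inf {enat (card A) | A. A \<subseteq> S \<and> finite A \<and> semigroup_span f A = S}"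

definition regular_elements :: "('b \<Rightarrow> 'b \<Rightarrow> 'b) \<Rightarrow> 'b set \<Rightarrow> 'b set" where
  "regular_elements f S = {x \<in> S. \<exists>y\<in>S. x = f (f x y) x}"

definition sandwich :: "'a::semiring_1 mat \<Rightarrow> 'a mat \<Rightarrow> 'a mat \<Rightarrow> 'a mat" where
  "sandwich J X Y = X * J * Y"

text \<open>The \<open>n \<times> m\<close> matrix of rank \<open>r\<close>; the truncated subtractions are harmless
  only for \<open>r \<le> min m n\<close>.\<close>

definition J_mat :: "nat \<Rightarrow> nat \<Rightarrow> nat \<Rightarrow> 'a::semiring_1 mat" where
  "J_mat n m r = four_block_mat (1\<^sub>m r) (0\<^sub>m r (m - r)) (0\<^sub>m (n - r) r) (0\<^sub>m (n - r) (m - r))"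

definition Reg_MJ :: "nat \<Rightarrow> nat \<Rightarrow> nat \<Rightarrow> 'a::field mat set" where
  "Reg_MJ m n r = regular_elements (sandwich (J_mat n m r)) (carrier_mat m n)"

end

theory Submission
  imports Defs "Jordan_Normal_Form.Determinant" "HOL-Algebra.Generated_Groups"
    "HOL-Algebra.Multiplicative_Group"
begin

text \<open>Write \<open>J = J\<^sub>n\<^sup>T J\<^sub>m\<close> with \<open>J\<^sub>k = [I\<^sub>r O]\<close>. The regular elements are exactly the products
  \<open>U A W\<^sup>T\<close> with \<open>J\<^sub>m U = I = J\<^sub>n W\<close> and \<open>A\<close> an arbitrary \<open>r \<times> r\<close> matrix, and
  \<open>(U, A, W) \<star> (U', A', W') = (U, A A', W')\<close>. A product with invertible middle factor involves only
  factors of this kind, and it has the \<open>U\<close> of its first and the \<open>W\<close> of its last factor; hence a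
  generating set needs one such element for each of the \<open>q ^ (r * (m - r))\<close> matrices \<open>U\<close> and each of
  the \<open>q ^ (r * (n - r))\<close> matrices \<open>W\<close>, and one further element with singular middle factor.

  Conversely, \<open>GL\<^sub>r\<close> has fewer than \<open>q ^ (r * r) \<le> 2 ^ (q ^ r + 1)\<close> elements and each new generator
  at least doubles a subgroup, so \<open>q ^ r \<le> q ^ (r * (L - r))\<close> elements generate \<open>GL\<^sub>r\<close>. Thus that many triples
  can cover all \<open>U\<close>, all \<open>W\<close> and a generating set of \<open>GL\<^sub>r\<close>, and a single idempotent of rank
  \<open>r - 1\<close> then produces all singular \<open>A\<close>.\<close>

section \<open>Generating sets of semigroups and finite groups\<close>

lemma semigroup_span_closed:
  assumes "A \<subseteq> S" and "\<And>x y. x \<in> S \<Longrightarrow> y \<in> S \<Longrightarrow> f x y \<in> S"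
  shows "semigroup_span f A \<subseteq> S"
proof
  fix x assume "x \<in> semigroup_span f A"
  then show "x \<in> S" by induction (use assms in auto)
qed

text \<open>An upper estimate for \<open>card A\<close> suffices: the last hypothesis, applied to
  \<open>A\<close> itself, gives the reverse one.\<close>

lemma semigroup_rank_eqI:
  assumes "A \<subseteq> S" "finite A" "semigroup_span f A = S" "card A \<le> k"
    and "\<And>B. B \<subseteq> S \<Longrightarrow> finite B \<Longrightarrow> semigroup_span f B = S \<Longrightarrow> k \<le> card B"
  shows "semigroup_rank f S = enat k"
  unfolding semigroup_rank_def
proof (rule antisym)
  let ?X = "{enat (card A) | A. A \<subseteq> S \<and> finite A \<and> semigroup_span f A = S}"
  have "enat (card A) \<in> ?X" using assms(1-3) by blast
  then have "Inf ?X \<le> enat (card A)" by (rule Inf_lower)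
  also have "\<dots> \<le> enat k" using assms(4) by simp
  finally show "Inf ?X \<le> enat k" .
  show "enat k \<le> Inf ?X" by (rule Inf_greatest) (use assms(5) in auto)
qed

text \<open>Products that leave the top part stay outside it, so only generators in the top part
  contribute to the values of an invariant of the left factor.\<close>

lemma semigroup_span_left_invariant:
  assumes "z \<in> semigroup_span f A" "T z"
    and S: "semigroup_span f A \<subseteq> S"
    and T: "\<And>x y. x \<in> S \<Longrightarrow> y \<in> S \<Longrightarrow> T (f x y) \<Longrightarrow> T x \<and> T y"
    and g: "\<And>x y. x \<in> S \<Longrightarrow> y \<in> S \<Longrightarrow> T x \<Longrightarrow> T y \<Longrightarrow> g (f x y) = g x"
  shows "g z \<in> g ` {x \<in> A. T x}"
  using assms(1,2)
proof induction
  case (mult x y)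
  then have "x \<in> S" "y \<in> S" using S by auto
  with mult T g show ?case by (metis (no_types, lifting))
qed auto

lemma semigroup_span_right_invariant:
  assumes "z \<in> semigroup_span f A" "T z"
    and S: "semigroup_span f A \<subseteq> S"
    and T: "\<And>x y. x \<in> S \<Longrightarrow> y \<in> S \<Longrightarrow> T (f x y) \<Longrightarrow> T x \<and> T y"
    and g: "\<And>x y. x \<in> S \<Longrightarrow> y \<in> S \<Longrightarrow> T x \<Longrightarrow> T y \<Longrightarrow> g (f x y) = g y"
  shows "g z \<in> g ` {x \<in> A. T x}"
  using assms(1,2)
proof induction
  case (mult x y)
  then have "x \<in> S" "y \<in> S" using S by auto
  with mult T g show ?case by (metis (no_types, lifting))
qed auto

text \<open>Enumerations with repetition let sets of different sizes share one index set, so that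
  sections and group generators can be listed in parallel.\<close>

lemma ex_onto_lessThan:
  assumes "finite B" "B \<noteq> {}" "card B \<le> k"
  shows "\<exists>f. f ` {..<k::nat} = B"
proof -
  obtain h where h: "bij_betw h {..<card B} B"
    using ex_bij_betw_nat_finite[OF assms(1)] by (auto simp: atLeast0LessThan)
  obtain b where b: "b \<in> B" using assms(2) by auto
  have "(\<lambda>i. if i < card B then h i else b) ` {..<k} = B"
    using h b assms(3) by (fastforce simp: bij_betw_def image_iff)
  then show ?thesis by blast
qed

text \<open>In a finite group the identity and all inverses are positive powers. The empty set is
  excluded since it generates the trivial subgroup but has empty semigroup span.\<close>

lemma (in group) generate_eq_semigroup_span:
  assumes "finite (carrier G)" "A \<subseteq> carrier G" "A \<noteq> {}"
  shows "generate G A = semigroup_span (\<otimes>) A"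
proof
  let ?S = "semigroup_span (\<otimes>) A"
  have S: "?S \<subseteq> carrier G" using assms(2) by (rule semigroup_span_closed) auto
  have pow: "a [^] Suc i \<in> ?S" if "a \<in> A" for a and i :: nat
  proof (induction i)
    case 0
    have "a \<in> carrier G" using that assms(2) by auto
    then show ?case using that by (simp add: semigroup_span.base)
  next
    case (Suc i)
    then show ?case using that by (simp add: semigroup_span.intros)
  qed
  have o: "order G > 0" using assms(1) by (simp add: order_gt_0_iff_finite)
  have one: "\<one> \<in> ?S"
  proof -
    obtain a where a: "a \<in> A" using assms(3) by auto
    with pow[OF a, of "order G - 1"] o assms(2) show ?thesis
      by (metis One_nat_def Suc_pred pow_order_eq_1 subsetD)
  qed
  have inv: "inv a \<in> ?S" if a: "a \<in> A" for a
  proof (cases "order G = 1")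
    case True
    have "a = \<one>" using a assms(2) True pow_order_eq_1[of a] by auto
    then show ?thesis using one by simp
  next
    case False
    have c: "a \<in> carrier G" using a assms(2) by auto
    \<comment> \<open>The inverse is the power with exponent \<open>order G - 1\<close>, here
      \<open>Suc i\<close>; this exponent is positive once the trivial group is set aside.\<close>
    define i where "i = order G - 2"
    have i: "order G = Suc (Suc i)" using False o unfolding i_def by linarith
    have "a [^] Suc i \<otimes> a = \<one>" using pow_order_eq_1[OF c] unfolding i by simp
    then have "inv a = a [^] Suc i" using c by (intro inv_equality) auto
    then show ?thesis using pow[OF a] by metis
  qed
  show "generate G A \<subseteq> ?S"
  proof
    fix x assume "x \<in> generate G A"
    then show "x \<in> ?S" by induction (auto intro: one inv semigroup_span.intros)
  qed
  show "?S \<subseteq> generate G A"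
    by (rule semigroup_span_closed) (auto intro: generate.intros)
qed

text \<open>\<open>H\<close> and its coset \<open>x H\<close> are disjoint, equally large and both
  contained in \<open>K\<close>.\<close>

lemma (in group) subgroup_doubling:
  assumes "finite (carrier G)" "subgroup H G" "subgroup K G" "H \<subseteq> K" "x \<in> K" "x \<notin> H"
  shows "2 * card H \<le> card K"
proof -
  have xc: "x \<in> carrier G" using assms(3,5) by (rule subgroup.mem_carrier)
  have Hc: "H \<subseteq> carrier G" using assms(2) by (rule subgroup.subset)
  have fK: "finite K" using subgroup.subset[OF assms(3)] assms(1) by (rule finite_subset)
  then have fH: "finite H" using assms(4) by (rule finite_subset[rotated])
  have inj: "inj_on (\<lambda>h. x \<otimes> h) H" using xc Hc by (auto intro!: inj_onI simp: subset_iff)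
  have "H \<inter> (\<lambda>h. x \<otimes> h) ` H = {}"
  proof (rule ccontr)
    assume "\<not> ?thesis"
    then obtain h where h: "h \<in> H" "x \<otimes> h \<in> H" by auto
    then have "(x \<otimes> h) \<otimes> inv h \<in> H"
      using assms(2) by (simp add: subgroup.m_closed subgroup.m_inv_closed)
    moreover have "(x \<otimes> h) \<otimes> inv h = x" using xc h Hc by (auto simp: m_assoc subset_iff)
    ultimately show False using assms(6) by simp
  qed
  then have "card (H \<union> (\<lambda>h. x \<otimes> h) ` H) = 2 * card H"
    using fH inj by (simp add: card_Un_disjoint card_image)
  moreover have "H \<union> (\<lambda>h. x \<otimes> h) ` H \<subseteq> K"
    using assms(3,4,5) by (auto simp: subgroup.m_closed subset_iff)
  ultimately show ?thesis using card_mono[OF fK] by metis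
qed

text \<open>Greedy choice: while the generated subgroup is proper, adjoining any element outside it
  at least doubles its order.\<close>

lemma (in group) ex_generate_large:
  assumes "finite (carrier G)"
  shows "\<exists>A \<subseteq> carrier G. card A \<le> k \<and> (generate G A = carrier G \<or> 2 ^ k \<le> card (generate G A))"
proof (induction k)
  case 0
  have "card (generate G {}) = 1" by (simp add: generate_empty)
  then show ?case by (intro exI[of _ "{}"]) auto
next
  case (Suc k)
  then obtain A where A: "A \<subseteq> carrier G" "card A \<le> k"
    and g: "generate G A = carrier G \<or> 2 ^ k \<le> card (generate G A)" by auto
  show ?case
  proof (cases "generate G A = carrier G")
    case True
    then show ?thesis using A by (intro exI[of _ A]) auto
  next
    case False
    then obtain x where x: "x \<in> carrier G" "x \<notin> generate G A" using generate_incl[OF A(1)] by auto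
    have ins: "insert x A \<subseteq> carrier G" using x A by auto
    have "2 * card (generate G A) \<le> card (generate G (insert x A))"
    proof (rule subgroup_doubling[OF assms])
      show "subgroup (generate G A) G" using A(1) by (rule generate_is_subgroup)
      show "subgroup (generate G (insert x A)) G" using ins by (rule generate_is_subgroup)
      show "generate G A \<subseteq> generate G (insert x A)" by (rule mono_generate) auto
      show "x \<in> generate G (insert x A)" by (rule generate.incl) simp
      show "x \<notin> generate G A" by fact
    qed
    moreover have "card (insert x A) \<le> Suc k" using A(2) card_insert_le_m1 card_insert_if
      by (metis Suc_le_mono finite_subset[OF A(1) assms] le_SucI)
    ultimately show ?thesis using g False ins by (intro exI[of _ "insert x A"]) auto
  qed
qed

text \<open>A subgroup still proper after \<open>k\<close> greedy choices would have order at least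
  \<open>2 ^ k\<close>, and the whole group then at least \<open>2 ^ Suc k\<close>.\<close>

lemma (in group) ex_small_generating_set:
  assumes fin: "finite (carrier G)" and k: "1 \<le> k" and le: "card (carrier G) < 2 ^ Suc k"
  shows "\<exists>A \<subseteq> carrier G. A \<noteq> {} \<and> card A \<le> k \<and> semigroup_span (\<otimes>) A = carrier G"
proof -
  obtain A where A: "A \<subseteq> carrier G" "card A \<le> k"
    and g: "generate G A = carrier G \<or> 2 ^ k \<le> card (generate G A)"
    using ex_generate_large[OF fin] by blast
  have gen: "generate G A = carrier G"
  proof (rule ccontr)
    assume n: "generate G A \<noteq> carrier G"
    then obtain x where x: "x \<in> carrier G" "x \<notin> generate G A" using generate_incl[OF A(1)] by auto
    have "2 * card (generate G A) \<le> card (carrier G)"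
      by (rule subgroup_doubling[OF fin generate_is_subgroup[OF A(1)] subgroup_self generate_incl[OF A(1)] x])
    with g n le show False by simp
  qed
  show ?thesis
  proof (cases "A = {}")
    \<comment> \<open>For the trivial group \<open>A\<close> may be empty; the singleton of the
      identity replaces it, and \<open>1 \<le> k\<close> leaves room for that.\<close>
    case True
    with gen have "carrier G = {\<one>}" by (simp add: generate_empty)
    moreover have "semigroup_span (\<otimes>) {\<one>} = generate G {\<one>}"
      by (rule generate_eq_semigroup_span[symmetric]) (use fin in auto)
    ultimately show ?thesis using k
      by (intro exI[of _ "{\<one>}"]) (auto simp: generate_one)
  next
    case False
    with A gen generate_eq_semigroup_span[OF fin] show ?thesis by metis
  qed
qed

text \<open>The exponent \<open>q ^ r + 1\<close> is sharp: equality holds for \<open>q = 2\<close>, \<open>r = 3\<close>.\<close>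

lemma power_square_le:
  fixes q r :: nat
  assumes q: "2 \<le> q" and r: "1 \<le> r"
  shows "q ^ (r * r) \<le> 2 ^ Suc (q ^ r)"
proof -
  obtain p where p: "q = p + 2" using q nat_le_iff_add by (metis add.commute)
  \<comment> \<open>From \<open>r = 4\<close> on the extra 1 is dispensable: passing to
    \<open>Suc r\<close> at most doubles the left side and multiplies the right side by
    \<open>q\<close>.\<close>
  have large: "r * r * (q - 1) \<le> q ^ r" if "4 \<le> r" for r
    using that
  proof (induction r rule: dec_induct)
    case base
    show ?case unfolding p by (simp add: algebra_simps power4_eq_xxxx)
  next
    case (step r)
    have "4 * r \<le> r * r" using step by simp
    then have "Suc r * Suc r \<le> 2 * (r * r)" using step(1) unfolding mult_Suc mult_Suc_right by linarith
    then have "Suc r * Suc r * (q - 1) \<le> 2 * (r * r) * (q - 1)" by (rule mult_le_mono1)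
    also have "\<dots> \<le> q * q ^ r" using mult_le_mono[OF q step.IH] by (simp add: mult.assoc)
    finally show ?case by simp
  qed
  have exp: "(q - 1) * (r * r) \<le> Suc (q ^ r)"
  proof (cases "4 \<le> r")
    case True
    then show ?thesis using large[of r] by (simp add: mult.commute)
  next
    case False
    \<comment> \<open>Here the extra 1 matters: for \<open>q = 2\<close> and \<open>r = 3\<close>
      both sides equal 9.\<close>
    then consider "r = 1" | "r = 2" | "r = 3" using r by linarith
    then show ?thesis unfolding p
      by cases (simp_all add: algebra_simps power2_eq_square power3_eq_cube)
  qed
  have "q \<le> 2 ^ (q - 1)" using self_le_ge2_pow[of 2 "q - 1"] less_exp[of "q - 1"] q by linarith
  then have "q ^ (r * r) \<le> (2 ^ (q - 1)) ^ (r * r)" by (rule power_mono) simp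
  also have "\<dots> = 2 ^ ((q - 1) * (r * r))" by (simp add: power_mult)
  also have "\<dots> \<le> 2 ^ Suc (q ^ r)" using exp by (rule power_increasing) simp
  finally show ?thesis .
qed

section \<open>Generation by units and an idempotent\<close>

text \<open>The right annihilator. For square matrices over a finite field its size grows with the
  dimension of the kernel, so it replaces the corank in a general finite ring.\<close>

definition annihilator :: "('r, 's) ring_scheme \<Rightarrow> 'r \<Rightarrow> 'r set" where
  "annihilator R a = {x \<in> carrier R. a \<otimes>\<^bsub>R\<^esub> x = \<zero>\<^bsub>R\<^esub>}"

text \<open>Induction on the size of the annihilator: with units \<open>p\<close>, \<open>t\<close> such that \<open>a p f = 0 = f t a\<close>, the
  element \<open>b = a p + t\<inverse> f\<close> fills the hole left by \<open>f\<close>, so \<open>a = b e p\<inverse>\<close> and \<open>b\<close> has a strictly smaller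
  annihilator.\<close>

lemma (in ring) units_and_idempotent_generate:
  assumes fin: "finite (carrier R)"
    and ef: "e \<in> carrier R" "f \<in> carrier R" "e \<oplus> f = \<one>" "f \<otimes> f = f" "f \<noteq> \<zero>"
    and right: "\<And>a. a \<in> carrier R \<Longrightarrow> a \<notin> Units R \<Longrightarrow> \<exists>p\<in>Units R. a \<otimes> p \<otimes> f = \<zero>"
    and left: "\<And>a. a \<in> carrier R \<Longrightarrow> a \<notin> Units R \<Longrightarrow> \<exists>p\<in>Units R. f \<otimes> p \<otimes> a = \<zero>"
    and a: "a \<in> carrier R"
  shows "a \<in> semigroup_span (\<otimes>) (insert e (Units R)) \<and> (\<exists>x\<in>carrier R. a \<otimes> x \<otimes> a = a)"
  using a
proof (induction "card (annihilator R a)" arbitrary: a rule: less_induct)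
  case (less a)
  let ?S = "semigroup_span (\<otimes>) (insert e (Units R))"
  note a = less.prems
  show ?case
  proof (cases "a \<in> Units R")
    case True
    then have "a \<in> ?S" "a \<otimes> inv a \<otimes> a = a" "inv a \<in> carrier R"
      by (auto intro: semigroup_span.base)
    then show ?thesis by blast
  next
    case False
    obtain p where p: "p \<in> Units R" "a \<otimes> p \<otimes> f = \<zero>" using right[OF a False] by auto
    obtain t where t: "t \<in> Units R" "f \<otimes> t \<otimes> a = \<zero>" using left[OF a False] by auto
    note [simp] = ef(1,2) a
    have c[simp]: "p \<in> carrier R" "t \<in> carrier R" "inv p \<in> carrier R" "inv t \<in> carrier R"
      using p t by auto
    have split_f: "x = e \<otimes> x \<oplus> f \<otimes> x" "x = x \<otimes> e \<oplus> x \<otimes> f" if "x \<in> carrier R" for x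
      using that ef(3) by (simp_all flip: l_distr r_distr)
    have fe: "f \<otimes> e = \<zero>"
      using split_f(2)[of f] ef(4) by (metis a_closed add.r_cancel_one ef(1,2) m_closed)
    have ee: "e \<otimes> e = e"
      using split_f(1)[of e] fe by simp
    \<comment> \<open>Left multiplication by \<open>u\<close> kills \<open>a p\<close> and recovers
      \<open>f\<close> from the added summand, so \<open>u b = f\<close>.\<close>
    define u where "u = f \<otimes> t"
    define b where "b = a \<otimes> p \<oplus> inv t \<otimes> f"
    have uc[simp]: "u \<in> carrier R" and bc[simp]: "b \<in> carrier R" by (auto simp: u_def b_def)
    have "u \<otimes> (a \<otimes> p) = \<zero>" using t by (simp add: u_def flip: m_assoc)
    moreover have "u \<otimes> (inv t \<otimes> f) = f"
      unfolding u_def by (metis Units_r_inv c ef(2,4) m_assoc m_closed r_one t(1))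
    ultimately have ub: "u \<otimes> b = f" by (simp add: b_def r_distr)
    have ape: "a \<otimes> p = a \<otimes> p \<otimes> e" using split_f(2)[of "a \<otimes> p"] p by simp
    have be: "b \<otimes> e = a \<otimes> p"
      using ape ee fe by (simp add: b_def l_distr m_assoc)
    have a_eq: "a = b \<otimes> e \<otimes> inv p" unfolding be using p by (simp add: m_assoc)
    have "card (annihilator R b) < card (annihilator R a)"
    proof -
      have fa: "finite (annihilator R a)" using fin by (simp add: annihilator_def)
      \<comment> \<open>Left multiplication by \<open>p\<close> embeds the annihilator of
        \<open>b\<close> into that of \<open>a\<close>: if \<open>b x = 0\<close>, then
        \<open>f x = u b x = 0\<close>, so \<open>x = e x\<close> and
        \<open>a p x = b e x = 0\<close>.\<close>
      have inj: "inj_on (\<lambda>x. p \<otimes> x) (annihilator R b)"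
        using p by (auto intro!: inj_onI simp: annihilator_def Units_l_cancel)
      have sub: "p \<otimes> x \<in> annihilator R a" if "x \<in> annihilator R b" for x
      proof -
        have x: "x \<in> carrier R" "b \<otimes> x = \<zero>" using that by (auto simp: annihilator_def)
        have "f \<otimes> x = u \<otimes> (b \<otimes> x)" using x(1) ub by (simp flip: m_assoc)
        then have "x = e \<otimes> x" using split_f(1)[OF x(1)] x by simp
        then have "a \<otimes> p \<otimes> x = b \<otimes> x" using x(1) be by (metis bc ef(1) m_assoc)
        then show ?thesis using x by (simp add: annihilator_def m_assoc)
      qed
      \<comment> \<open>This element makes the inclusion strict, as \<open>b f = 0\<close> would
        give \<open>f = u b f = 0\<close>.\<close>
      have "p \<otimes> f \<in> annihilator R a" using p by (simp add: annihilator_def flip: m_assoc)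
      moreover have "p \<otimes> f \<notin> (\<lambda>x. p \<otimes> x) ` annihilator R b"
      proof
        assume "p \<otimes> f \<in> (\<lambda>x. p \<otimes> x) ` annihilator R b"
        then have "b \<otimes> f = \<zero>" using p by (auto simp: annihilator_def Units_l_cancel)
        then have "u \<otimes> b \<otimes> f = \<zero>" by (simp add: m_assoc)
        then show False using ub ef by simp
      qed
      ultimately have "(\<lambda>x. p \<otimes> x) ` annihilator R b \<subset> annihilator R a" using sub by blast
      then show ?thesis using psubset_card_mono[OF fa] card_image[OF inj] by metis
    qed
    from less.hyps[OF this] obtain y where b: "b \<in> ?S" and y: "y \<in> carrier R" "b \<otimes> y \<otimes> b = b" by auto
    have "a \<in> ?S" unfolding a_eq
      by (intro semigroup_span.mult b semigroup_span.base) (use p(1) in auto)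
    \<comment> \<open>An inner inverse \<open>y\<close> of \<open>b\<close> yields
      \<open>p y\<close> for \<open>a\<close>: since \<open>f y b e = u b y b e = f e = 0\<close>, a
      factor \<open>e\<close> can be inserted before \<open>y b e\<close>.\<close>
    moreover have "a \<otimes> (p \<otimes> y) \<otimes> a = a"
    proof -
      have "f \<otimes> (y \<otimes> (b \<otimes> e)) = u \<otimes> (b \<otimes> y \<otimes> b \<otimes> e)" using y(1) by (simp add: m_assoc flip: ub)
      also have "\<dots> = \<zero>" using y ub fe by (simp flip: m_assoc)
      finally have "y \<otimes> (b \<otimes> e) = e \<otimes> (y \<otimes> (b \<otimes> e))"
        using split_f(1)[of "y \<otimes> (b \<otimes> e)"] y by simp
      then have "b \<otimes> e \<otimes> (y \<otimes> (b \<otimes> e)) = b \<otimes> y \<otimes> b \<otimes> e" using y(1) by (simp add: m_assoc)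
      then have "b \<otimes> e \<otimes> (y \<otimes> (b \<otimes> e)) = b \<otimes> e" using y by simp
      then have "a \<otimes> p \<otimes> (y \<otimes> (a \<otimes> p \<otimes> inv p)) = a \<otimes> p \<otimes> inv p"
        unfolding be using y(1) by (metis (no_types, lifting) c a m_assoc m_closed)
      then show ?thesis using p y by (simp add: m_assoc)
    qed
    moreover have "p \<otimes> y \<in> carrier R" using y by simp
    ultimately show ?thesis by blast
  qed
qed

section \<open>Counting matrices over a finite field through their entry functions\<close>

lemma carrier_mat_eq_image:
  "carrier_mat a b = (\<lambda>f. mat a b f) ` (({..<a} \<times> {..<b}) \<rightarrow>\<^sub>E (UNIV :: 'a set))"
proof (intro equalityI subsetI)
  fix A :: "'a mat" assume A: "A \<in> carrier_mat a b"
  have "A = mat a b (restrict (($$) A) ({..<a} \<times> {..<b}))"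
    by (rule eq_matI) (use A in auto)
  then show "A \<in> (\<lambda>f. mat a b f) ` (({..<a} \<times> {..<b}) \<rightarrow>\<^sub>E UNIV)" by auto
qed auto

lemma inj_on_mat: "inj_on (\<lambda>f. mat a b f) (({..<a} \<times> {..<b}) \<rightarrow>\<^sub>E UNIV)"
proof (rule inj_onI)
  fix f g :: "nat \<times> nat \<Rightarrow> 'a"
  assume f: "f \<in> ({..<a} \<times> {..<b}) \<rightarrow>\<^sub>E UNIV" "g \<in> ({..<a} \<times> {..<b}) \<rightarrow>\<^sub>E UNIV"
    and eq: "mat a b f = mat a b g"
  show "f = g"
  proof (rule PiE_ext[OF f])
    fix p assume "p \<in> {..<a} \<times> {..<b}"
    then show "f p = g p" using arg_cong[OF eq, of "\<lambda>M. M $$ p"] by auto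
  qed
qed

lemma finite_carrier_mat:
  "finite (UNIV :: 'a set) \<Longrightarrow> finite (carrier_mat a b :: 'a mat set)"
  unfolding carrier_mat_eq_image by (intro finite_imageI finite_PiE) auto

lemma card_carrier_mat:
  "finite (UNIV :: 'a set) \<Longrightarrow> card (carrier_mat a b :: 'a mat set) = card (UNIV :: 'a set) ^ (a * b)"
  unfolding carrier_mat_eq_image by (simp add: card_image[OF inj_on_mat] card_PiE prod_constant)

lemma mat_mult_index:
  assumes "A \<in> carrier_mat a k" "B \<in> carrier_mat k b" "i < a" "j < b"
  shows "(A * B) $$ (i, j) = (\<Sum>h<k. A $$ (i, h) * B $$ (h, j))"
  using assms by (auto simp: scalar_prod_def atLeast0LessThan intro!: sum.cong)

section \<open>The general linear group and the generation of all square matrices\<close>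

definition mat_GL :: "nat \<Rightarrow> 'a::field mat set" where
  "mat_GL r = Units (ring_mat TYPE('a) r ())"

text \<open>For \<open>r \<ge> 1\<close> an idempotent of rank \<open>r - 1\<close>. Its zero sits
  in the last position to match the zero row that elimination creates in a singular matrix.\<close>

definition corank_one :: "nat \<Rightarrow> 'a::field mat" where
  "corank_one r = mat r r (\<lambda>(i, j). if i = j \<and> Suc i < r then 1 else 0)"

lemma corank_one_carrier [simp]: "corank_one r \<in> carrier_mat r r"
  by (simp add: corank_one_def)

lemma mat_GL_iff_det:
  "A \<in> mat_GL r \<longleftrightarrow> A \<in> carrier_mat r r \<and> det A \<noteq> 0"
  unfolding mat_GL_def
  using unit_imp_det_non_zero[of A r "()"] det_non_zero_imp_unit[of A r "()"]
  by (auto simp: Units_def ring_mat_def)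

lemma mat_GL_mult_iff:
  assumes "A \<in> carrier_mat r r" "B \<in> carrier_mat r r"
  shows "A * B \<in> mat_GL r \<longleftrightarrow> A \<in> mat_GL r \<and> B \<in> mat_GL r"
  using assms by (auto simp: mat_GL_iff_det det_mult)

lemma mat_GL_inverse:
  assumes "A \<in> mat_GL r"
  obtains B where "B \<in> mat_GL r" "A * B = 1\<^sub>m r" "B * A = 1\<^sub>m r"
proof -
  interpret R: ring "ring_mat TYPE('a) r ()" by (rule ring_mat)
  have A: "A \<in> Units (ring_mat TYPE('a) r ())" using assms by (simp add: mat_GL_def)
  show thesis
    by (rule that[unfolded mat_GL_def, OF R.Units_inv_Units[OF A]])
      (use R.Units_r_inv[OF A] R.Units_l_inv[OF A] in \<open>simp_all add: ring_mat_simps\<close>)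
qed

text \<open>Row operations give a singular matrix a zero last row, and left multiplication by
  \<open>F\<close> retains only that row.\<close>

lemma singular_zero_row:
  fixes A :: "'a::field mat"
  assumes A: "A \<in> carrier_mat r r" "A \<notin> mat_GL r" and F: "F = 1\<^sub>m r - corank_one r"
  shows "\<exists>P\<in>mat_GL r. F * P * A = 0\<^sub>m r r"
proof -
  have "det A = 0" using A by (simp add: mat_GL_iff_det)
  then obtain P where P: "P \<in> mat_GL r" and row: "row (P * A) (r - 1) = 0\<^sub>v r"
    using det_zero_imp_zero_row[OF A(1), of "()"] by (auto simp: mat_GL_def)
  have Pc: "P \<in> carrier_mat r r" using P by (simp add: mat_GL_iff_det)
  have Fc: "F \<in> carrier_mat r r" unfolding F by (rule minus_carrier_mat) simp
  have "F * (P * A) = 0\<^sub>m r r"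
  proof (rule eq_matI)
    fix i j assume "i < dim_row (0\<^sub>m r r :: 'a mat)" "j < dim_col (0\<^sub>m r r :: 'a mat)"
    then have ij: "i < r" "j < r" by auto
    have z: "(P * A) $$ (r - 1, j) = 0"
      using arg_cong[OF row, of "\<lambda>v. v $ j"] ij Pc A by auto
    have "(F * (P * A)) $$ (i, j) = (\<Sum>k<r. F $$ (i, k) * (P * A) $$ (k, j))"
      by (rule mat_mult_index[of _ r r _ r]) (use ij Fc Pc A in auto)
    also have "\<dots> = 0"
    proof (rule sum.neutral, intro ballI)
      fix k assume "k \<in> {..<r}"
      then consider "Suc k < r" | "k = r - 1" by fastforce
      then show "F $$ (i, k) * (P * A) $$ (k, j) = 0"
      proof cases
        case 1
        then have "F $$ (i, k) = 0" using ij by (auto simp: F corank_one_def)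
        then show ?thesis by simp
      qed (use z in simp)
    qed
    finally show "(F * (P * A)) $$ (i, j) = 0\<^sub>m r r $$ (i, j)" using ij by simp
  qed (use Fc Pc A in auto)
  then show ?thesis using P Fc Pc A by (intro bexI[of _ P]) auto
qed

text \<open>Transposition of the row version; \<open>F\<close> is diagonal, hence symmetric.\<close>

lemma singular_zero_col:
  fixes A :: "'a::field mat"
  assumes A: "A \<in> carrier_mat r r" "A \<notin> mat_GL r" and F: "F = 1\<^sub>m r - corank_one r"
  shows "\<exists>P\<in>mat_GL r. A * P * F = 0\<^sub>m r r"
proof -
  have "A\<^sup>T \<in> carrier_mat r r" "A\<^sup>T \<notin> mat_GL r" using A by (auto simp: mat_GL_iff_det det_transpose)
  from singular_zero_row[OF this F] obtain P where P: "P \<in> mat_GL r" "F * P * A\<^sup>T = 0\<^sub>m r r" by auto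
  have Pc: "P \<in> carrier_mat r r" using P by (simp add: mat_GL_iff_det)
  have Fc: "F \<in> carrier_mat r r" unfolding F by (rule minus_carrier_mat) simp
  have FT: "F\<^sup>T = F" unfolding F by (rule eq_matI) (auto simp: corank_one_def)
  have "(F * P * A\<^sup>T)\<^sup>T = A * P\<^sup>T * F"
    using A Pc Fc FT by (simp add: transpose_mult[of _ r r _ r])
  moreover have "P\<^sup>T \<in> mat_GL r" using P by (simp add: mat_GL_iff_det det_transpose[OF Pc])
  ultimately show ?thesis using P(2) by (metis zero_transpose_mat)
qed

text \<open>The ring lemma with \<open>corank_one r\<close> as \<open>e\<close>. Von Neumann
  regularity comes out of the same induction and later supplies inner inverses in the sandwich
  semigroup.\<close>

lemma square_mat_generation:
  fixes A :: "'a::field mat"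
  assumes fin: "finite (UNIV :: 'a set)" and r: "1 \<le> r" and A: "A \<in> carrier_mat r r"
  shows "A \<in> semigroup_span (*) (insert (corank_one r) (mat_GL r)) \<and>
    (\<exists>X\<in>carrier_mat r r. A * X * A = A)"
proof -
  interpret R: ring "ring_mat TYPE('a) r ()" by (rule ring_mat)
  let ?F = "1\<^sub>m r - corank_one r :: 'a mat"
  have F: "?F = mat r r (\<lambda>(i, j). if i = j \<and> Suc i = r then 1 else 0)"
    by (rule eq_matI) (auto simp: corank_one_def)
  have Fc: "?F \<in> carrier_mat r r" by (rule minus_carrier_mat) simp
  have "?F * ?F = ?F"
  proof (rule eq_matI)
    fix i j assume "i < dim_row ?F" "j < dim_col ?F"
    then have ij: "i < r" "j < r" using Fc by auto
    have "(?F * ?F) $$ (i, j) = (\<Sum>k<r. ?F $$ (i, k) * ?F $$ (k, j))"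
      by (rule mat_mult_index[OF Fc Fc ij])
    also have "\<dots> = (\<Sum>k<r. if k = i then ?F $$ (i, i) * ?F $$ (i, j) else 0)"
      by (rule sum.cong) (use ij in \<open>auto simp: F\<close>)
    also have "\<dots> = ?F $$ (i, j)" using ij by (auto simp: F)
    finally show "(?F * ?F) $$ (i, j) = ?F $$ (i, j)" .
  qed (use Fc in auto)
  moreover have "?F \<noteq> 0\<^sub>m r r"
  proof
    assume "?F = 0\<^sub>m r r"
    from arg_cong[OF this, of "\<lambda>M. M $$ (r - 1, r - 1)"] show False using r by (simp add: F)
  qed
  moreover have "corank_one r + ?F = 1\<^sub>m r" by (rule eq_matI) (auto simp: corank_one_def)
  moreover have "\<exists>P\<in>mat_GL r. ?F * P * B = 0\<^sub>m r r" "\<exists>P\<in>mat_GL r. B * P * ?F = 0\<^sub>m r r"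
    if "B \<in> carrier_mat r r" "B \<notin> mat_GL r" for B :: "'a mat"
    using singular_zero_row[OF that refl] singular_zero_col[OF that refl] by auto
  ultimately show ?thesis
    by (intro R.units_and_idempotent_generate[of "corank_one r" ?F A, unfolded ring_mat_simps, folded mat_GL_def])
      (use A Fc in \<open>simp_all add: finite_carrier_mat[OF fin]\<close>)
qed

lemma mat_GL_generation:
  assumes fin: "finite (UNIV :: 'a::field set)" and r: "1 \<le> r"
  shows "\<exists>G \<subseteq> mat_GL r :: 'a mat set. G \<noteq> {} \<and> card G \<le> card (UNIV :: 'a set) ^ r \<and>
    semigroup_span (*) G = mat_GL r"
proof -
  let ?q = "card (UNIV :: 'a set)"
  interpret R: ring "ring_mat TYPE('a) r ()" by (rule ring_mat)
  interpret G: group "units_of (ring_mat TYPE('a) r ())" by (rule R.units_group)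
  have carr: "carrier (units_of (ring_mat TYPE('a) r ())) = mat_GL r"
    by (simp add: units_of_def mat_GL_def)
  have mult: "mult (units_of (ring_mat TYPE('a) r ())) = (*)"
    by (simp add: units_of_def ring_mat_simps)
  have "card {0, 1 :: 'a} \<le> ?q" by (rule card_mono[OF fin]) simp
  then have q: "2 \<le> ?q" by simp
  have fc: "finite (carrier_mat r r :: 'a mat set)" using fin by (rule finite_carrier_mat)
  \<comment> \<open>For \<open>r \<ge> 1\<close> the zero matrix is singular; this makes the bound
    on the order of the group strict, as the generator count demands.\<close>
  have "0\<^sub>m r r \<notin> (mat_GL r :: 'a mat set)" using r by (simp add: mat_GL_iff_det)
  then have "mat_GL r \<subset> (carrier_mat r r :: 'a mat set)"
    by (auto simp: mat_GL_iff_det)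
  then have lt: "card (mat_GL r :: 'a mat set) < card (carrier_mat r r :: 'a mat set)"
    and fG: "finite (mat_GL r :: 'a mat set)"
    using fc by (auto intro: psubset_card_mono finite_subset)
  note lt
  also have "card (carrier_mat r r :: 'a mat set) \<le> 2 ^ Suc (?q ^ r)"
    using card_carrier_mat[OF fin] power_square_le[OF q r] by simp
  finally show ?thesis
    using G.ex_small_generating_set[of "?q ^ r"] fG q unfolding carr mult by simp
qed

section \<open>Coordinates on the regular elements\<close>

text \<open>For \<open>r \<le> k\<close> this is the matrix
  \<open>J\<^sub>k = [I\<^sub>r O]\<close>; left multiplication by it keeps the first
  \<open>r\<close> rows.\<close>

definition top_rows :: "nat \<Rightarrow> nat \<Rightarrow> 'a::semiring_1 mat" where
  "top_rows r k = mat r k (\<lambda>(i, j). if i = j then 1 else 0)"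

definition top_sections :: "nat \<Rightarrow> nat \<Rightarrow> 'a::semiring_1 mat set" where
  "top_sections r k = {U \<in> carrier_mat k r. top_rows r k * U = 1\<^sub>m r}"

lemma top_rows_carrier [simp]: "top_rows r k \<in> carrier_mat r k"
  by (simp add: top_rows_def)

lemma top_rows_mult_carrier [simp]:
  "Y \<in> carrier_mat k l \<Longrightarrow> top_rows r k * Y \<in> carrier_mat r l"
  by (rule mult_carrier_mat[OF top_rows_carrier])

lemma top_rows_mult_index:
  assumes "U \<in> carrier_mat k l" "r \<le> k" "i < r" "j < l"
  shows "(top_rows r k * U) $$ (i, j) = U $$ (i, j)"
proof -
  have "(top_rows r k * U) $$ (i, j) = (\<Sum>h<k. if h = i then U $$ (i, j) else 0)"
    unfolding mat_mult_index[OF top_rows_carrier assms(1,3,4)]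
    by (rule sum.cong) (use assms in \<open>auto simp: top_rows_def\<close>)
  also have "\<dots> = U $$ (i, j)" using assms by simp
  finally show ?thesis .
qed

lemma top_sections_iff:
  assumes "r \<le> k"
  shows "U \<in> top_sections r k \<longleftrightarrow> U \<in> carrier_mat k r \<and> (\<forall>i<r. \<forall>j<r. U $$ (i, j) = (if i = j then 1 else 0))"
proof (cases "U \<in> carrier_mat k r")
  case True
  have "top_rows r k * U = 1\<^sub>m r \<longleftrightarrow> (\<forall>i<r. \<forall>j<r. (top_rows r k * U) $$ (i, j) = (if i = j then 1 else 0))"
    using True by (auto simp: mat_eq_iff) (auto simp: top_rows_def)
  also have "\<dots> \<longleftrightarrow> (\<forall>i<r. \<forall>j<r. U $$ (i, j) = (if i = j then 1 else 0))"
    using top_rows_mult_index[OF True assms] by auto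
  finally show ?thesis using True by (simp add: top_sections_def)
qed (simp add: top_sections_def)

lemma transpose_top_rows_section:
  assumes "r \<le> k"
  shows "(top_rows r k)\<^sup>T \<in> top_sections r k"
  using assms by (auto simp: top_sections_iff[OF assms]) (auto simp: top_rows_def)

text \<open>This factorization splits a sandwich product into two parts that depend on one factor
  each.\<close>

lemma J_mat_eq_top_rows:
  assumes "r \<le> n" "r \<le> m"
  shows "J_mat n m r = (top_rows r n)\<^sup>T * top_rows r m"
proof (rule eq_matI)
  fix i j assume "i < dim_row ((top_rows r n)\<^sup>T * top_rows r m :: 'a mat)"
    "j < dim_col ((top_rows r n)\<^sup>T * top_rows r m :: 'a mat)"
  then have ij: "i < n" "j < m" by (auto simp: top_rows_def)
  have "((top_rows r n)\<^sup>T * top_rows r m) $$ (i, j) =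
      (\<Sum>h<r. if h = i then (if i = j then 1 else 0) else (0 :: 'a))"
    unfolding mat_mult_index[OF transpose_carrier_mat[THEN iffD2, OF top_rows_carrier] top_rows_carrier ij]
    by (rule sum.cong) (use ij assms in \<open>auto simp: top_rows_def\<close>)
  also have "\<dots> = (if i < r \<and> i = j then 1 else 0)" by simp
  also have "\<dots> = J_mat n m r $$ (i, j)" using ij assms by (auto simp: J_mat_def)
  finally show "J_mat n m r $$ (i, j) = ((top_rows r n)\<^sup>T * top_rows r m :: 'a mat) $$ (i, j)" ..
qed (use assms in \<open>auto simp: J_mat_def top_rows_def\<close>)

text \<open>A section is the identity stacked on an arbitrary block with \<open>k - r\<close> rows
  and \<open>r\<close> columns.\<close>

lemma card_top_sections:
  assumes fin: "finite (UNIV :: 'a::field set)" and r: "r \<le> k"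
  shows "card (top_sections r k :: 'a mat set) = card (UNIV :: 'a set) ^ (r * (k - r))"
proof -
  define h :: "'a mat \<Rightarrow> 'a mat" where "h M = 1\<^sub>m r @\<^sub>r M" for M
  have "bij_betw h (carrier_mat (k - r) r) (top_sections r k)"
  proof (rule bij_betw_byWitness[where f' = "\<lambda>U. mat (k - r) r (\<lambda>(i, j). U $$ (i + r, j))"])
    show "h ` carrier_mat (k - r) r \<subseteq> top_sections r k"
      using r by (auto simp: top_sections_iff h_def append_rows_def intro!: carrier_matI)
    show "\<forall>M\<in>carrier_mat (k - r) r. mat (k - r) r (\<lambda>(i, j). h M $$ (i + r, j)) = M"
      by (auto simp: h_def append_rows_def intro!: eq_matI)
    show "\<forall>U\<in>top_sections r k. h (mat (k - r) r (\<lambda>(i, j). U $$ (i + r, j))) = U"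
      using r by (auto simp: top_sections_iff h_def append_rows_def intro!: eq_matI)
  qed auto
  then have "card (carrier_mat (k - r) r :: 'a mat set) = card (top_sections r k :: 'a mat set)"
    by (rule bij_betw_same_card)
  then show ?thesis using card_carrier_mat[OF fin, of "k - r" r] by (simp add: mult.commute)
qed

lemma finite_top_sections:
  "finite (UNIV :: 'a::field set) \<Longrightarrow> finite (top_sections r k :: 'a mat set)"
  unfolding top_sections_def by (simp add: finite_carrier_mat)

text \<open>The third argument is transposed only here, so that one notion of section serves both
  sides.\<close>

definition tri_prod :: "'a::field mat \<Rightarrow> 'a mat \<Rightarrow> 'a mat \<Rightarrow> 'a mat" where
  "tri_prod U A W = U * A * W\<^sup>T"

text \<open>The upper left \<open>r\<close> by \<open>r\<close> block when both dimensions are at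
  least \<open>r\<close>.\<close>

definition mat_core :: "nat \<Rightarrow> 'a::field mat \<Rightarrow> 'a mat" where
  "mat_core r X = top_rows r (dim_row X) * X * (top_rows r (dim_col X))\<^sup>T"

lemma mat_core_carrier [simp]: "mat_core r X \<in> carrier_mat r r"
  by (auto simp: mat_core_def top_rows_def)

lemma top_sections_transpose_mult:
  fixes W :: "'a::field mat"
  assumes "W \<in> top_sections r n"
  shows "W\<^sup>T * (top_rows r n)\<^sup>T = 1\<^sub>m r"
proof -
  have "(top_rows r n * W)\<^sup>T = W\<^sup>T * (top_rows r n)\<^sup>T"
    using assms by (intro transpose_mult[OF top_rows_carrier, of _ _ r]) (simp add: top_sections_def)
  then show ?thesis using assms by (simp add: top_sections_def)
qed

section \<open>The sandwich product in these coordinates\<close>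

context
  fixes m n r :: nat
  assumes r: "r \<le> m" "r \<le> n"
begin

lemma tri_prod_carrier:
  "U \<in> top_sections r m \<Longrightarrow> A \<in> carrier_mat r r \<Longrightarrow> W \<in> top_sections r n \<Longrightarrow>
    tri_prod U A W \<in> carrier_mat m n"
  by (auto simp: tri_prod_def top_sections_def)

lemma top_rows_mult_tri_prod:
  assumes "U \<in> top_sections r m" "A \<in> carrier_mat r r" "W \<in> top_sections r n"
  shows "top_rows r m * tri_prod U A W = A * W\<^sup>T"
proof -
  have U: "U \<in> carrier_mat m r" "top_rows r m * U = 1\<^sub>m r" and W: "W \<in> carrier_mat n r"
    using assms by (auto simp: top_sections_def)
  have "top_rows r m * (U * A * W\<^sup>T) = (top_rows r m * U) * A * W\<^sup>T"
    using U(1) W assms(2) by (simp add: assoc_mult_mat[of _ r m _ r _ r] assoc_mult_mat[of _ r m _ r _ n]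
        assoc_mult_mat[of _ m r _ r _ n] assoc_mult_mat[of _ r r _ r _ n])
  then show ?thesis using U assms(2) by (simp add: tri_prod_def)
qed

lemma tri_prod_mult_top_rows:
  assumes "U \<in> top_sections r m" "A \<in> carrier_mat r r" "W \<in> top_sections r n"
  shows "tri_prod U A W * (top_rows r n)\<^sup>T = U * A"
proof -
  have U: "U \<in> carrier_mat m r" and W: "W \<in> carrier_mat n r"
    using assms by (auto simp: top_sections_def)
  have "U * A * W\<^sup>T * (top_rows r n)\<^sup>T = U * A * (W\<^sup>T * (top_rows r n)\<^sup>T)"
    using U W assms(2) by (intro assoc_mult_mat[of _ m r _ n _ r]) auto
  then show ?thesis using U assms top_sections_transpose_mult[OF assms(3)] by (simp add: tri_prod_def)
qed

lemma mat_core_tri_prod: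
  assumes "U \<in> top_sections r m" "A \<in> carrier_mat r r" "W \<in> top_sections r n"
  shows "mat_core r (tri_prod U A W) = A"
proof -
  have c: "W \<in> carrier_mat n r" using assms by (auto simp: top_sections_def)
  have "mat_core r (tri_prod U A W) = A * W\<^sup>T * (top_rows r n)\<^sup>T"
    using top_rows_mult_tri_prod[OF assms] tri_prod_carrier[OF assms] by (simp add: mat_core_def)
  also have "\<dots> = A * (W\<^sup>T * (top_rows r n)\<^sup>T)"
    using c assms(2) by (intro assoc_mult_mat[of _ r r _ n _ r]) auto
  finally show ?thesis using assms(2) top_sections_transpose_mult[OF assms(3)] by simp
qed

lemma sandwich_J_mat:
  assumes "X \<in> carrier_mat m n" "Y \<in> carrier_mat m n"
  shows "sandwich (J_mat n m r) X Y = X * (top_rows r n)\<^sup>T * (top_rows r m * Y)"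
proof -
  let ?T = "(top_rows r n)\<^sup>T"
  have c: "?T \<in> carrier_mat n r" "X * ?T \<in> carrier_mat m r" using assms by auto
  have "X * (?T * top_rows r m) = X * ?T * top_rows r m"
    by (rule assoc_mult_mat[OF assms(1) c(1) top_rows_carrier, symmetric])
  then show ?thesis unfolding sandwich_def J_mat_eq_top_rows[OF r(2,1)]
    using assoc_mult_mat[OF c(2) top_rows_carrier assms(2)] by simp
qed

lemma sandwich_carrier:
  "X \<in> carrier_mat m n \<Longrightarrow> Y \<in> carrier_mat m n \<Longrightarrow> sandwich (J_mat n m r) X Y \<in> carrier_mat m n"
  by (rule carrier_matI) (auto simp: sandwich_def)

lemma top_rows_mult_sandwich:
  assumes "X \<in> carrier_mat m n" "Y \<in> carrier_mat m n"
  shows "top_rows r m * sandwich (J_mat n m r) X Y = mat_core r X * (top_rows r m * Y)"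
proof -
  let ?T = "(top_rows r n)\<^sup>T"
  have c: "?T \<in> carrier_mat n r" "X * ?T \<in> carrier_mat m r" "top_rows r m * Y \<in> carrier_mat r n"
    using assms by auto
  have "top_rows r m * (X * ?T * (top_rows r m * Y)) = top_rows r m * (X * ?T) * (top_rows r m * Y)"
    by (rule assoc_mult_mat[OF top_rows_carrier c(2,3), symmetric])
  also have "top_rows r m * (X * ?T) = mat_core r X"
    using assms assoc_mult_mat[OF top_rows_carrier assms(1) c(1)] by (simp add: mat_core_def)
  finally show ?thesis using assms by (simp add: sandwich_J_mat)
qed

lemma sandwich_mult_top_rows:
  assumes "X \<in> carrier_mat m n" "Y \<in> carrier_mat m n"
  shows "sandwich (J_mat n m r) X Y * (top_rows r n)\<^sup>T = X * (top_rows r n)\<^sup>T * mat_core r Y"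
proof -
  let ?T = "(top_rows r n)\<^sup>T"
  have c: "?T \<in> carrier_mat n r" "X * ?T \<in> carrier_mat m r" "top_rows r m * Y \<in> carrier_mat r n"
    using assms by auto
  show ?thesis using assms assoc_mult_mat[OF c(2,3,1)] by (simp add: sandwich_J_mat mat_core_def)
qed

text \<open>Each factor of \<open>J\<close> is absorbed by its neighbour. Invertibility of the core
  of a product is thus decided by the two cores separately.\<close>

lemma mat_core_sandwich:
  assumes "X \<in> carrier_mat m n" "Y \<in> carrier_mat m n"
  shows "mat_core r (sandwich (J_mat n m r) X Y) = mat_core r X * mat_core r Y"
proof -
  have "mat_core r (sandwich (J_mat n m r) X Y) = mat_core r X * (top_rows r m * Y) * (top_rows r n)\<^sup>T"
    using top_rows_mult_sandwich[OF assms] sandwich_carrier[OF assms] by (simp add: mat_core_def)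
  also have "\<dots> = mat_core r X * (top_rows r m * Y * (top_rows r n)\<^sup>T)"
    using assms by (intro assoc_mult_mat[of _ r r _ n _ r]) auto
  finally show ?thesis using assms by (simp add: mat_core_def)
qed

text \<open>The products of \<open>J\<^sub>n\<close> with \<open>W\<close> and of
  \<open>J\<^sub>m\<close> with \<open>U'\<close> are identities. Triples multiply as in a
  rectangular band times the full matrix monoid, though different triples may give the same matrix
  when \<open>A\<close> is singular.\<close>

lemma sandwich_tri_prod:
  assumes "U \<in> top_sections r m" "A \<in> carrier_mat r r" "W \<in> top_sections r n"
    and "U' \<in> top_sections r m" "A' \<in> carrier_mat r r" "W' \<in> top_sections r n"
  shows "sandwich (J_mat n m r) (tri_prod U A W) (tri_prod U' A' W') = tri_prod U (A * A') W'"
proof -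
  have c: "U \<in> carrier_mat m r" "W' \<in> carrier_mat n r" using assms by (auto simp: top_sections_def)
  have "sandwich (J_mat n m r) (tri_prod U A W) (tri_prod U' A' W') = U * A * (A' * W'\<^sup>T)"
    using assms by (simp add: sandwich_J_mat tri_prod_carrier tri_prod_mult_top_rows top_rows_mult_tri_prod)
  then show ?thesis using c assms(2,5)
    by (simp add: tri_prod_def assoc_mult_mat[of _ m r _ r _ r] assoc_mult_mat[of _ m r _ r _ n]
        assoc_mult_mat[of _ r r _ r _ n])
qed

end

lemma mat_GL_cancel_right:
  assumes "P \<in> mat_GL r" "M \<in> carrier_mat k r" "N \<in> carrier_mat k r"
  shows "M * P = N * P \<longleftrightarrow> M = N"
proof
  obtain Q where Q: "Q \<in> mat_GL r" "P * Q = 1\<^sub>m r" using mat_GL_inverse[OF assms(1)] by metis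
  have c: "P \<in> carrier_mat r r" "Q \<in> carrier_mat r r" using assms(1) Q(1) by (auto simp: mat_GL_iff_det)
  assume "M * P = N * P"
  then have "M * P * Q = N * P * Q" by simp
  then show "M = N" using assms(2,3) c Q(2)
    by (simp add: assoc_mult_mat[of _ k r _ r _ r])
qed simp

lemma mat_GL_cancel_left:
  assumes "P \<in> mat_GL r" "M \<in> carrier_mat r k" "N \<in> carrier_mat r k"
  shows "P * M = P * N \<longleftrightarrow> M = N"
proof
  obtain Q where Q: "Q \<in> mat_GL r" "Q * P = 1\<^sub>m r" using mat_GL_inverse[OF assms(1)] by metis
  have c: "P \<in> carrier_mat r r" "Q \<in> carrier_mat r r" using assms(1) Q(1) by (auto simp: mat_GL_iff_det)
  assume "P * M = P * N"
  then have "Q * (P * M) = Q * (P * N)" by simp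
  then show "M = N" using assms(2,3) c Q(2)
    by (simp flip: assoc_mult_mat[of _ r r _ r _ k])
qed simp

text \<open>The matrix \<open>U0 E\<close> is a section up to \<open>1 - A E\<close>; adding this defect in the top rows
  does not change the product with any \<open>V\<close> fixed by \<open>A E\<close>.\<close>

lemma ex_top_section:
  fixes U0 :: "'a::field mat"
  assumes r: "r \<le> k" and U0: "U0 \<in> carrier_mat k r" "top_rows r k * U0 = A"
    and A: "A \<in> carrier_mat r r" and E: "E \<in> carrier_mat r r"
  shows "\<exists>U\<in>top_sections r k. \<forall>l. \<forall>V\<in>carrier_mat r l. A * E * V = V \<longrightarrow> U * V = U0 * E * V"
proof -
  let ?T = "top_rows r k :: 'a mat"
  let ?D = "1\<^sub>m r - A * E"
  define U where "U = U0 * E + ?T\<^sup>T * ?D"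
  have TT: "?T * ?T\<^sup>T = 1\<^sub>m r" and Tc: "?T\<^sup>T \<in> carrier_mat k r"
    using transpose_top_rows_section[OF r] by (auto simp: top_sections_def)
  have AE: "A * E \<in> carrier_mat r r" using A E by simp
  then have D: "?D \<in> carrier_mat r r" by (rule minus_carrier_mat)
  have c: "U0 * E \<in> carrier_mat k r" "?T\<^sup>T * ?D \<in> carrier_mat k r"
    by (rule mult_carrier_mat[OF U0(1) E], rule mult_carrier_mat[OF Tc D])
  have "?T * U = ?T * (U0 * E) + ?T * (?T\<^sup>T * ?D)"
    unfolding U_def by (rule mult_add_distrib_mat[OF top_rows_carrier c])
  also have "?T * (U0 * E) = A * E"
    using assoc_mult_mat[OF top_rows_carrier[of r k] U0(1) E] U0(2) by simp
  also have "?T * (?T\<^sup>T * ?D) = ?D"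
    using assoc_mult_mat[OF top_rows_carrier[of r k] Tc D] TT left_mult_one_mat[OF D] by simp
  also have "A * E + ?D = 1\<^sub>m r" by (rule eq_matI) (use A E AE in auto)
  finally have "U \<in> top_sections r k" using c by (auto simp: top_sections_def U_def)
  moreover have "U * V = U0 * E * V" if V: "V \<in> carrier_mat r l" "A * E * V = V" for l V
  proof -
    have "?D * V = 1\<^sub>m r * V - A * E * V" using minus_mult_distrib_mat[OF one_carrier_mat AE V(1)] .
    also have "\<dots> = 0\<^sub>m r l" using V by simp
    finally have "?D * V = 0\<^sub>m r l" .
    then have "?T\<^sup>T * ?D * V = 0\<^sub>m k l" using assoc_mult_mat[OF Tc D V(1)] right_mult_zero_mat[OF Tc] by simp
    then show ?thesis
      using add_mult_distrib_mat[OF c V(1)] c V(1) unfolding U_def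
      by (metis mult_carrier_mat right_add_zero_mat)
  qed
  ultimately show ?thesis by blast
qed

text \<open>An inner inverse of \<open>A\<close> lifts to one of the triple product. Conversely,
  with cores \<open>A\<close> of \<open>X\<close> and \<open>E\<close> of \<open>Y\<close>,
  regularity turns into \<open>X = U0 E V0\<close> and \<open>A E V0 = V0\<close>; the section lemma
  replaces \<open>U0 E\<close> by a section \<open>U\<close>, and its transposed use factors
  \<open>V0\<close> through \<open>A\<close>.\<close>

lemma Reg_MJ_eq:
  fixes m n r :: nat
  assumes fin: "finite (UNIV :: 'a::field set)" and r: "1 \<le> r" "r \<le> m" "r \<le> n"
  shows "(Reg_MJ m n r :: 'a mat set) =
    {tri_prod U A W | U A W. U \<in> top_sections r m \<and> A \<in> carrier_mat r r \<and> W \<in> top_sections r n}"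
    (is "_ = ?R")
proof (intro equalityI subsetI)
  fix X :: "'a mat" assume "X \<in> ?R"
  then obtain U A W where X: "X = tri_prod U A W"
    and c: "U \<in> top_sections r m" "A \<in> carrier_mat r r" "W \<in> top_sections r n" by auto
  obtain E where E: "E \<in> carrier_mat r r" "A * E * A = A"
    using square_mat_generation[OF fin r(1) c(2)] by auto
  let ?Y = "tri_prod ((top_rows r m)\<^sup>T) E ((top_rows r n)\<^sup>T)"
  note T = transpose_top_rows_section[OF r(2)] transpose_top_rows_section[OF r(3)]
  have "sandwich (J_mat n m r) (sandwich (J_mat n m r) X ?Y) X = X"
    unfolding X using sandwich_tri_prod[OF r(2,3) c T(1) E(1) T(2)]
      sandwich_tri_prod[OF r(2,3) c(1) mult_carrier_mat[OF c(2) E(1)] T(2) c] E(2) by simp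
  moreover have "X \<in> carrier_mat m n" "?Y \<in> carrier_mat m n"
    unfolding X using c E T r by (auto intro!: tri_prod_carrier)
  ultimately show "X \<in> Reg_MJ m n r" unfolding Reg_MJ_def regular_elements_def
    by (intro CollectI conjI bexI[of _ ?Y]) simp_all
next
  fix X :: "'a mat" assume "X \<in> Reg_MJ m n r"
  then obtain Y where X: "X \<in> carrier_mat m n" and Y: "Y \<in> carrier_mat m n"
    and reg: "X = sandwich (J_mat n m r) (sandwich (J_mat n m r) X Y) X"
    by (auto simp: Reg_MJ_def regular_elements_def)
  let ?A = "mat_core r X" let ?E = "mat_core r Y"
  let ?U0 = "X * (top_rows r n)\<^sup>T" let ?V0 = "top_rows r m * X"
  have XY: "sandwich (J_mat n m r) X Y \<in> carrier_mat m n"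
    using sandwich_carrier[OF r(2,3) X Y] .
  have U0: "?U0 \<in> carrier_mat m r" and V0: "?V0 \<in> carrier_mat r n"
    using X by auto
  have A: "?A = top_rows r m * ?U0" "?A = ?V0 * (top_rows r n)\<^sup>T"
    using X assoc_mult_mat[OF top_rows_carrier[of r m] X, of "(top_rows r n)\<^sup>T" r]
    by (auto simp: mat_core_def)
  have AEA: "?A * ?E * ?A = ?A"
    using reg mat_core_sandwich[OF r(2,3) XY X] mat_core_sandwich[OF r(2,3) X Y] by simp
  have AEV: "?A * ?E * ?V0 = ?V0"
    using reg top_rows_mult_sandwich[OF r(2,3) XY X] mat_core_sandwich[OF r(2,3) X Y] by simp
  have UEV: "X = ?U0 * ?E * ?V0"
    using reg sandwich_J_mat[OF r(2,3) XY X] sandwich_mult_top_rows[OF r(2,3) X Y] by simp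
  obtain U where U: "U \<in> top_sections r m" "U * ?V0 = X"
    using ex_top_section[OF r(2) U0 A(1)[symmetric] mat_core_carrier mat_core_carrier] AEV V0 UEV by metis
  have T: "top_rows r n * ?V0\<^sup>T = ?A\<^sup>T"
    unfolding A(2) using transpose_mult[OF V0, of "(top_rows r n)\<^sup>T" r] by simp
  have tr: "?A\<^sup>T * ?E\<^sup>T * ?A\<^sup>T = ?A\<^sup>T" "?V0\<^sup>T * ?E\<^sup>T * ?A\<^sup>T = ?V0\<^sup>T"
  proof -
    have c: "?A \<in> carrier_mat r r" "?E \<in> carrier_mat r r" by auto
    have "(?A * ?E)\<^sup>T = ?E\<^sup>T * ?A\<^sup>T" by (rule transpose_mult[OF c])
    then have "(?A * ?E * ?A)\<^sup>T = ?A\<^sup>T * (?E\<^sup>T * ?A\<^sup>T)" "(?A * ?E * ?V0)\<^sup>T = ?V0\<^sup>T * (?E\<^sup>T * ?A\<^sup>T)"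
      using transpose_mult[OF mult_carrier_mat[OF c] c(1)] transpose_mult[OF mult_carrier_mat[OF c] V0]
      by simp_all
    then show "?A\<^sup>T * ?E\<^sup>T * ?A\<^sup>T = ?A\<^sup>T" "?V0\<^sup>T * ?E\<^sup>T * ?A\<^sup>T = ?V0\<^sup>T"
      using AEA AEV V0 c by (metis assoc_mult_mat transpose_carrier_mat)+
  qed
  obtain W where W: "W \<in> top_sections r n" "W * ?A\<^sup>T = ?V0\<^sup>T"
    \<comment> \<open>The transpose of \<open>V0\<close> takes the place of \<open>U0\<close>, and
      the transpose of \<open>A\<close> that of both \<open>A\<close> and \<open>V\<close>.\<close>
    using ex_top_section[OF r(3) transpose_carrier_mat[THEN iffD2, OF V0] T, of "?E\<^sup>T"] tr
    by (metis mat_core_carrier transpose_carrier_mat)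
  have Wc: "W \<in> carrier_mat n r" and Uc: "U \<in> carrier_mat m r"
    using U W by (auto simp: top_sections_def)
  have "?A * W\<^sup>T = ?V0"
    using arg_cong[OF W(2), of transpose_mat] transpose_mult[OF Wc, of "?A\<^sup>T" r] by simp
  then have "X = tri_prod U ?A W"
    using U(2) Uc Wc by (simp add: tri_prod_def assoc_mult_mat[of _ m r _ r _ n])
  then show "X \<in> ?R" using U W mat_core_carrier by blast
qed

text \<open>Three surjective lists of length \<open>K\<close> are zipped into triples, so the count
  is governed by the maximum of the three sizes and not by their sum.\<close>

lemma Reg_MJ_generated:
  fixes m n r K :: nat
  assumes fin: "finite (UNIV :: 'a::field set)" and r: "1 \<le> r" "r \<le> m" "r \<le> n"
    and K: "card (top_sections r m :: 'a mat set) \<le> K" "card (top_sections r n :: 'a mat set) \<le> K"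
      "card (UNIV :: 'a set) ^ r \<le> K"
  shows "\<exists>B \<subseteq> Reg_MJ m n r :: 'a mat set. finite B \<and> card B \<le> K + 1 \<and>
    semigroup_span (sandwich (J_mat n m r)) B = Reg_MJ m n r"
proof -
  let ?f = "sandwich (J_mat n m r) :: 'a mat \<Rightarrow> 'a mat \<Rightarrow> 'a mat"
  let ?Sm = "top_sections r m :: 'a mat set" let ?Sn = "top_sections r n :: 'a mat set"
  note T = transpose_top_rows_section[OF r(2)] transpose_top_rows_section[OF r(3)]
  obtain G :: "'a mat set" where G: "G \<subseteq> mat_GL r" "G \<noteq> {}" "card G \<le> K"
    and spanG: "semigroup_span (*) G = mat_GL r"
    using mat_GL_generation[OF fin r(1)] K(3) order_trans by metis
  have GLc: "mat_GL r \<subseteq> (carrier_mat r r :: 'a mat set)" by (auto simp: mat_GL_iff_det)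
  have "finite G" using finite_carrier_mat[OF fin] GLc G(1) by (meson finite_subset)
  then obtain g where g: "g ` {..<K} = G" using ex_onto_lessThan G by metis
  obtain u where u: "u ` {..<K} = ?Sm"
    using ex_onto_lessThan[OF finite_top_sections[OF fin] _ K(1)] T(1) by blast
  obtain w where w: "w ` {..<K} = ?Sn"
    using ex_onto_lessThan[OF finite_top_sections[OF fin] _ K(2)] T(2) by blast
  have gGL: "g i \<in> mat_GL r" and gc: "g i \<in> carrier_mat r r" and uS: "u i \<in> ?Sm" and wS: "w i \<in> ?Sn"
    if "i < K" for i using that g u w G(1) GLc by auto
  define e where "e = tri_prod ((top_rows r m)\<^sup>T) (corank_one r) ((top_rows r n)\<^sup>T :: 'a mat)"
  define B where "B = insert e ((\<lambda>i. tri_prod (u i) (g i) (w i)) ` {..<K})"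
  have "card B \<le> card ((\<lambda>i. tri_prod (u i) (g i) (w i)) ` {..<K}) + 1"
    unfolding B_def by (simp add: card_insert_if)
  also have "\<dots> \<le> K + 1" using card_image_le[of "{..<K}" "\<lambda>i. tri_prod (u i) (g i) (w i)"] by simp
  finally have cB: "card B \<le> K + 1" .
  have BP: "B \<subseteq> Reg_MJ m n r"
    unfolding Reg_MJ_eq[OF fin r] B_def e_def using T gc uS wS corank_one_carrier by blast
  let ?S = "semigroup_span ?f B"
  have comb: "tri_prod U (A * A') W' \<in> ?S"
    if "tri_prod U A W \<in> ?S" "tri_prod U' A' W' \<in> ?S"
      "U \<in> ?Sm" "A \<in> carrier_mat r r" "W \<in> ?Sn" "U' \<in> ?Sm" "A' \<in> carrier_mat r r" "W' \<in> ?Sn"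
    for U A W U' A' W'
    using semigroup_span.mult[OF that(1,2)] sandwich_tri_prod[OF r(2,3) that(3-8)] by simp
  have gen: "tri_prod (u i) (g i) (w i) \<in> ?S" if "i < K" for i
    using that by (auto simp: B_def intro: semigroup_span.base)
  \<comment> \<open>Products of generators first realize each invertible core with uncontrolled
    outer sections.\<close>
  have some: "A \<in> carrier_mat r r \<and> (\<exists>U\<in>?Sm. \<exists>W\<in>?Sn. tri_prod U A W \<in> ?S)"
    if "A \<in> semigroup_span (*) G" for A
    using that
  proof induction
    case (base A)
    then obtain i where "i < K" "A = g i" using g by auto
    then show ?case using gen gc uS wS by blast
  next
    case (mult A A')
    then show ?case by (meson comb mult_carrier_mat)
  qed
  have top: "tri_prod U A W \<in> ?S" if A: "A \<in> mat_GL r" and UW: "U \<in> ?Sm" "W \<in> ?Sn" for U A W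
  proof -
    obtain i j where ij: "i < K" "u i = U" "j < K" "w j = W"
      using u w UW by (metis imageE lessThan_iff)
    \<comment> \<open>The inverses \<open>a\<close> and \<open>b\<close> compensate for the cores
      \<open>g i\<close> and \<open>g j\<close> that come along with the prescribed sections
      \<open>U\<close> and \<open>W\<close>.\<close>
    obtain a where a: "a \<in> mat_GL r" "g i * a = 1\<^sub>m r" using mat_GL_inverse[OF gGL[OF ij(1)]] by metis
    obtain b where b: "b \<in> mat_GL r" "b * g j = 1\<^sub>m r" using mat_GL_inverse[OF gGL[OF ij(3)]] by metis
    have c: "a \<in> carrier_mat r r" "b \<in> carrier_mat r r" "A \<in> carrier_mat r r"
      "g i \<in> carrier_mat r r" "g j \<in> carrier_mat r r"
      using a b A ij gc GLc by auto
    have "a * A * b \<in> mat_GL r" using a b A c by (simp add: mat_GL_mult_iff)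
    then obtain U' W' where s: "U' \<in> ?Sm" "W' \<in> ?Sn" "tri_prod U' (a * A * b) W' \<in> ?S"
      using some spanG by metis
    have "tri_prod U (g i * (a * A * b)) W' \<in> ?S"
      using comb[OF gen[OF ij(1)] s(3)] s c ij uS wS by auto
    then have "tri_prod U (g i * (a * A * b) * g j) W \<in> ?S"
      using comb[OF _ gen[OF ij(3)], of U "g i * (a * A * b)" W'] s c ij uS wS UW by auto
    moreover have "g i * (a * A * b) * g j = (g i * a) * A * (b * g j)"
      using c by (simp add: assoc_mult_mat[of _ r r _ r _ r])
    ultimately show ?thesis using a b c by simp
  qed
  have one: "1\<^sub>m r \<in> (mat_GL r :: 'a mat set)" by (simp add: mat_GL_iff_det)
  have all: "A \<in> carrier_mat r r \<and> (\<forall>U\<in>?Sm. \<forall>W\<in>?Sn. tri_prod U A W \<in> ?S)"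
    if "A \<in> semigroup_span (*) (insert (corank_one r) (mat_GL r))" for A
    using that
  proof induction
    case (base A)
    show ?case
    proof (cases "A \<in> mat_GL r")
      case True
      then show ?thesis using top GLc by blast
    next
      case False
      then have A: "A = corank_one r" using base by auto
      have Ac: "A \<in> carrier_mat r r" by (simp add: A)
      have eS: "tri_prod ((top_rows r m)\<^sup>T) A ((top_rows r n)\<^sup>T) \<in> ?S"
        unfolding A by (rule semigroup_span.base) (simp add: B_def e_def)
      have "tri_prod U A W \<in> ?S" if UW: "U \<in> ?Sm" "W \<in> ?Sn" for U W
      proof -
        \<comment> \<open>Triples with identity core, multiplied on either side, exchange the outer
          sections of \<open>e\<close>.\<close>
        have "tri_prod U (1\<^sub>m r * A) ((top_rows r n)\<^sup>T) \<in> ?S"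
          by (rule comb[OF top[OF one UW] eS]) (use UW T Ac in auto)
        then have "tri_prod U A ((top_rows r n)\<^sup>T) \<in> ?S" using Ac by simp
        then have "tri_prod U (A * 1\<^sub>m r) W \<in> ?S"
          by (rule comb[OF _ top[OF one UW]]) (use UW T Ac in auto)
        then show ?thesis using Ac by simp
      qed
      then show ?thesis using Ac by blast
    qed
  next
    case (mult A A')
    have "tri_prod U (A * A') W \<in> ?S" if "U \<in> ?Sm" "W \<in> ?Sn" for U W
      using that mult.IH by (intro comb[of U A W U A' W]) auto
    then show ?case using mult.IH by auto
  qed
  have "?S = Reg_MJ m n r"
  proof
    show "?S \<subseteq> Reg_MJ m n r"
    proof (rule semigroup_span_closed[OF BP])
      fix x y :: "'a mat" assume "x \<in> Reg_MJ m n r" "y \<in> Reg_MJ m n r"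
      then show "?f x y \<in> Reg_MJ m n r"
        unfolding Reg_MJ_eq[OF fin r] using sandwich_tri_prod[OF r(2,3)] mult_carrier_mat by blast
    qed
    show "Reg_MJ m n r \<subseteq> ?S"
      unfolding Reg_MJ_eq[OF fin r] using all square_mat_generation[OF fin r(1)] by blast
  qed
  then show ?thesis using BP cB by (intro exI[of _ B]) (auto simp: B_def)
qed

text \<open>Both bounds come from the same set \<open>?C\<close> of generators with invertible core,
  which is always a proper subset of \<open>B\<close>.\<close>

lemma card_generating_set_Reg_MJ:
  fixes m n r :: nat and B :: "'a::field mat set"
  assumes fin: "finite (UNIV :: 'a set)" and r: "1 \<le> r" "r \<le> m" "r \<le> n"
    and B: "B \<subseteq> Reg_MJ m n r" "finite B"
    and span: "semigroup_span (sandwich (J_mat n m r)) B = Reg_MJ m n r"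
  shows "card (top_sections r m :: 'a mat set) + 1 \<le> card B"
    and "card (top_sections r n :: 'a mat set) + 1 \<le> card B"
proof -
  let ?f = "sandwich (J_mat n m r) :: 'a mat \<Rightarrow> 'a mat \<Rightarrow> 'a mat"
  let ?Sm = "top_sections r m :: 'a mat set" let ?Sn = "top_sections r n :: 'a mat set"
  note T = transpose_top_rows_section[OF r(2)] transpose_top_rows_section[OF r(3)]
  let ?T = "\<lambda>X :: 'a mat. mat_core r X \<in> mat_GL r"
  let ?C = "{x \<in> B. ?T x}"
  have PC: "(Reg_MJ m n r :: 'a mat set) \<subseteq> carrier_mat m n"
    by (auto simp: Reg_MJ_def regular_elements_def)
  have closed: "?T x \<and> ?T y" if "x \<in> carrier_mat m n" "y \<in> carrier_mat m n" "?T (?f x y)" for x y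
    using that by (simp add: mat_core_sandwich[OF r(2,3)] mat_GL_mult_iff)
  \<comment> \<open>The first coordinate as a set: for \<open>X = tri_prod U A W\<close> with
    \<open>A\<close> invertible, the equation reads \<open>U' A = U A\<close> and the value is
    \<open>{U}\<close>. No coordinates have to be chosen; \<open>h\<close> treats \<open>W\<close>
    in the same way.\<close>
  define g where "g X = {U \<in> ?Sm. U * mat_core r X = X * (top_rows r n)\<^sup>T}" for X
  define h where "h X = {W \<in> ?Sn. mat_core r X * W\<^sup>T = top_rows r m * X}" for X
  have g_inv: "g (?f x y) = g x"
    if xy: "x \<in> carrier_mat m n" "y \<in> carrier_mat m n" "?T x" "?T y" for x y
  proof -
    have "U * (mat_core r x * mat_core r y) = x * (top_rows r n)\<^sup>T * mat_core r y \<longleftrightarrow>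
        U * mat_core r x = x * (top_rows r n)\<^sup>T" if "U \<in> ?Sm" for U
    proof -
      have "U \<in> carrier_mat m r" using that by (simp add: top_sections_def)
      then have c: "U * mat_core r x \<in> carrier_mat m r" "x * (top_rows r n)\<^sup>T \<in> carrier_mat m r"
        and "U * (mat_core r x * mat_core r y) = U * mat_core r x * mat_core r y"
        using xy by (auto simp: assoc_mult_mat[of _ m r _ r _ r])
      then show ?thesis using mat_GL_cancel_right[OF xy(4) c] by simp
    qed
    then show ?thesis unfolding g_def
      using xy by (auto simp: mat_core_sandwich[OF r(2,3)] sandwich_mult_top_rows[OF r(2,3)])
  qed
  have h_inv: "h (?f x y) = h y"
    if xy: "x \<in> carrier_mat m n" "y \<in> carrier_mat m n" "?T x" "?T y" for x y
  proof -
    have "mat_core r x * mat_core r y * W\<^sup>T = mat_core r x * (top_rows r m * y) \<longleftrightarrow>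
        mat_core r y * W\<^sup>T = top_rows r m * y" if "W \<in> ?Sn" for W
    proof -
      have W: "W\<^sup>T \<in> carrier_mat r n" using that by (simp add: top_sections_def)
      have c: "mat_core r y * W\<^sup>T \<in> carrier_mat r n" "top_rows r m * y \<in> carrier_mat r n"
        and "mat_core r x * mat_core r y * W\<^sup>T = mat_core r x * (mat_core r y * W\<^sup>T)"
        using xy mult_carrier_mat[OF mat_core_carrier W]
          assoc_mult_mat[OF mat_core_carrier mat_core_carrier W] by auto
      then show ?thesis using mat_GL_cancel_left[OF xy(3) c] by simp
    qed
    then show ?thesis unfolding h_def
      using xy by (auto simp: mat_core_sandwich[OF r(2,3)] top_rows_mult_sandwich[OF r(2,3)])
  qed
  have one: "1\<^sub>m r \<in> (mat_GL r :: 'a mat set)" "1\<^sub>m r \<in> (carrier_mat r r :: 'a mat set)"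
    by (auto simp: mat_GL_iff_det)
  have S: "semigroup_span ?f B \<subseteq> carrier_mat m n" using span PC by simp
  have tri_span: "tri_prod U (1\<^sub>m r) W \<in> semigroup_span ?f B" "mat_core r (tri_prod U (1\<^sub>m r) W) = 1\<^sub>m r"
    if "U \<in> ?Sm" "W \<in> ?Sn" for U W
    using that one mat_core_tri_prod[OF r(2,3) that(1) _ that(2)] unfolding span Reg_MJ_eq[OF fin r] by blast+
  have "{U} \<in> g ` ?C" if U: "U \<in> ?Sm" for U
  proof -
    let ?z = "tri_prod U (1\<^sub>m r) ((top_rows r n)\<^sup>T)"
    have "?z * (top_rows r n)\<^sup>T = U"
      using tri_prod_mult_top_rows[OF r(2,3) U one(2) T(2)] U right_mult_one_mat[of U m r]
      by (simp add: top_sections_def)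
    then have "g ?z = {U}"
      using U by (auto simp: g_def tri_span(2)[OF U T(2)] top_sections_def)
    moreover have "g ?z \<in> g ` ?C"
      by (rule semigroup_span_left_invariant[where T = ?T and g = g, OF tri_span(1)[OF U T(2)] _ S closed g_inv])
        (simp_all add: tri_span(2)[OF U T(2)] one)
    ultimately show ?thesis by simp
  qed
  then have "card ((\<lambda>U. {U}) ` ?Sm) \<le> card (g ` ?C)" using B(2) by (intro card_mono) auto
  also have "\<dots> \<le> card ?C" by (rule card_image_le) (use B(2) in auto)
  finally have m: "card ?Sm \<le> card ?C" by (simp add: card_image)
  have "{W} \<in> h ` ?C" if W: "W \<in> ?Sn" for W
  proof -
    let ?z = "tri_prod ((top_rows r m)\<^sup>T) (1\<^sub>m r) W"
    have "top_rows r m * ?z = W\<^sup>T"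
      using top_rows_mult_tri_prod[OF r(2,3) T(1) one(2) W] W left_mult_one_mat[of "W\<^sup>T" r n]
      by (simp add: top_sections_def)
    then have "h ?z = {W}"
      using W by (auto simp: h_def tri_span(2)[OF T(1) W] top_sections_def)
    moreover have "h ?z \<in> h ` ?C"
      by (rule semigroup_span_right_invariant[where T = ?T and g = h, OF tri_span(1)[OF T(1) W] _ S closed h_inv])
        (simp_all add: tri_span(2)[OF T(1) W] one)
    ultimately show ?thesis by simp
  qed
  then have "card ((\<lambda>W. {W}) ` ?Sn) \<le> card (h ` ?C)" using B(2) by (intro card_mono) auto
  also have "\<dots> \<le> card ?C" by (rule card_image_le) (use B(2) in auto)
  finally have n: "card ?Sn \<le> card ?C" by (simp add: card_image)
  have "?C \<noteq> B"
  proof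
    assume eq: "?C = B"
    \<comment> \<open>If every generator had an invertible core, so would every product, yet the
      zero matrix is regular.\<close>
    let ?P = "{x \<in> carrier_mat m n. ?T x}"
    let ?z = "tri_prod ((top_rows r m)\<^sup>T) (0\<^sub>m r r) ((top_rows r n)\<^sup>T) :: 'a mat"
    have "semigroup_span ?f B \<subseteq> ?P"
    proof (rule semigroup_span_closed)
      show "B \<subseteq> ?P" using eq B(1) PC by blast
      show "?f x y \<in> ?P" if "x \<in> ?P" "y \<in> ?P" for x y
        using that by (simp add: sandwich_carrier[OF r(2,3)] mat_core_sandwich[OF r(2,3)] mat_GL_mult_iff)
    qed
    moreover have "?z \<in> semigroup_span ?f B" unfolding span Reg_MJ_eq[OF fin r]
      using T zero_carrier_mat by blast
    ultimately have "?T ?z" by blast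
    then have "0\<^sub>m r r \<in> (mat_GL r :: 'a mat set)"
      by (simp add: mat_core_tri_prod[OF r(2,3) T(1) zero_carrier_mat T(2)])
    then show False using r(1) by (simp add: mat_GL_iff_det)
  qed
  then have "card ?C < card B" using B(2) by (intro psubset_card_mono) auto
  then show "card ?Sm + 1 \<le> card B" "card ?Sn + 1 \<le> card B" using m n by auto
qed

theorem theorem6p10:
  fixes m n r q L :: nat
  assumes "finite (UNIV :: 'a::field set)"
    and "card (UNIV :: 'a set) = q"
    and "1 \<le> m" and "1 \<le> n"
    and "1 \<le> r" and "r \<le> min m n"
    and "\<not> (r = m \<and> m = n)"
    and "L = max m n"
  shows "semigroup_rank (sandwich (J_mat n m r)) (Reg_MJ m n r :: 'a mat set)
           = enat (q ^ (r * (L - r)) + 1)"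
proof -
  let ?K = "q ^ (r * (L - r))"
  have r: "1 \<le> r" "r \<le> m" "r \<le> n" using assms by auto
  have q: "1 \<le> q" using assms(1,2) by (auto simp: Suc_le_eq card_gt_0_iff)
  note card_sec = card_top_sections[OF assms(1), unfolded assms(2)]
  have le: "q ^ (r * (k - r)) \<le> ?K" if "k \<le> L" for k
    using that q by (intro power_increasing mult_le_mono2) auto
  \<comment> \<open>Excluding \<open>r = m = n\<close> is decisive here: it makes \<open>?K\<close>
    at least \<open>q ^ r\<close>, enough for generators of the general linear group.\<close>
  have "1 \<le> L - r" using assms(6-8) by auto
  then have "r * 1 \<le> r * (L - r)" by (rule mult_le_mono2)
  then have K: "q ^ r \<le> ?K" using q by (intro power_increasing) auto
  obtain B :: "'a mat set" where B: "B \<subseteq> Reg_MJ m n r" "finite B" "card B \<le> ?K + 1"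
    "semigroup_span (sandwich (J_mat n m r)) B = Reg_MJ m n r"
    using Reg_MJ_generated[OF assms(1) r, of ?K] le[of m] le[of n] K assms(2,8) card_sec r by auto
  show ?thesis
  proof (rule semigroup_rank_eqI[OF B(1,2,4,3)])
    fix C :: "'a mat set"
    assume C: "C \<subseteq> Reg_MJ m n r" "finite C" "semigroup_span (sandwich (J_mat n m r)) C = Reg_MJ m n r"
    \<comment> \<open>\<open>L\<close> is \<open>m\<close> or \<open>n\<close>, and the bound for
      that side is the required one.\<close>
    show "?K + 1 \<le> card C"
      using card_generating_set_Reg_MJ[OF assms(1) r C] card_sec[OF r(2)] card_sec[OF r(3)] assms(8)
      by (simp add: max_def split: if_splits)
  qed
qed

end
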